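(* For every real $\gamma>0$ the following holds for all sufficiently large integers $n$ divisible by $3$. If $H$ is a $3$-graph on $n$ vertices which is induced $K_4^-$-free and satisfies $\delta_2(H)\ge (1/3+\gamma)n$, then $H$ contains a perfect matching.
   Context: A $3$-graph $H$ has edge set a family of $3$-element subsets of $V(H)$. $K_4^-$ is the unique (up to isomorphism) $3$-graph with $4$ vertices and $3$ edges. $H$ is induced $K_4^-$-free if there is no $4$-set $W\subseteq V(H)$ such that exactly $3$ of the $3$-subsets of $W$ are edges of $H$. For distinct vertices $x,y$, $\deg_H(\{x,y\})$ is the number of vertices $z$ with $\{x,y,z\}\in E(H)$, and $\delta_2(H)$ is the minimum of this over all pairs. A perfect matching is a set of pairwise vertex-disjoint edges covering all vertices. *)

theory Defs
  imports Complex_Main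
begin

definition three_graph :: "'a set \<Rightarrow> 'a set set \<Rightarrow> bool" where
  "three_graph V E \<longleftrightarrow> finite V \<and> (\<forall>e\<in>E. e \<subseteq> V \<and> card e = 3)"

definition induced_K4_minus_free :: "'a set \<Rightarrow> 'a set set \<Rightarrow> bool" where
  "induced_K4_minus_free V E \<longleftrightarrow>
     \<not> (\<exists>W. W \<subseteq> V \<and> card W = 4 \<and> card {e \<in> E. e \<subseteq> W \<and> card e = 3} = 3)"

(* If x and y are distinct, then z = x and z = y are not counted,
   because all edges of a 3-graph have three elements. *)
definition pair_degree :: "'a set \<Rightarrow> 'a set set \<Rightarrow> 'a \<Rightarrow> 'a \<Rightarrow> nat" where
  "pair_degree V E x y = card {z \<in> V. {x, y, z} \<in> E}"

(* Min is meaningful here only if V has at least two vertices. *)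
definition min_pair_degree :: "'a set \<Rightarrow> 'a set set \<Rightarrow> nat" where
  "min_pair_degree V E = Min {pair_degree V E x y | x y. x \<in> V \<and> y \<in> V \<and> x \<noteq> y}"

definition perfect_matching :: "'a set \<Rightarrow> 'a set set \<Rightarrow> 'a set set \<Rightarrow> bool" where
  "perfect_matching V E M \<longleftrightarrow> M \<subseteq> E \<and> pairwise disjnt M \<and> \<Union>M = V"

end

theory Submission
  imports Defs "HOL-Real_Asymp.Real_Asymp"
begin

text \<open>
  In an induced \<open>K\<^sub>4\<^sup>-\<close>-free 3-graph, two of the neighbourhoods of the three pairs of an edge meet
  only inside the third, so codegree \<open>(1/3 + \<gamma>)n\<close> puts every edge in at least \<open>3\<gamma>n/2\<close> copies of
  \<open>K\<^sub>4\<close>. Hence any two vertices \<open>a, z\<close> have quadratically many common link edges \<open>bc\<close>. Taking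
  \<open>a\<close> in the neighbourhood of \<open>xy\<close>, a non-edge \<open>xyz\<close> is absorbed by cubically many edges \<open>abc\<close>,
  since \<open>abc\<close> together with \<open>xyz\<close> splits into the edges \<open>xya\<close> and \<open>zbc\<close>. Greedily choosing the
  most popular absorber gives a small matching absorbing every non-edge. In the rest, a maximum
  matching misses at most three vertices, because three disjoint uncovered pairs would
  send more than three edges to some matching edge and allow a swap; these three vertices are
  then absorbed.
\<close>

section \<open>Matchings in 3-graphs\<close>

definition matching :: "'a set set \<Rightarrow> 'a set set \<Rightarrow> bool" where
  "matching E M \<longleftrightarrow> M \<subseteq> E \<and> pairwise disjnt M"

lemma perfect_matching_iff: "perfect_matching V E M \<longleftrightarrow> matching E M \<and> \<Union>M = V"
  by (simp add: perfect_matching_def matching_def)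

lemma matching_empty [simp]: "matching E {}"
  by (simp add: matching_def)

lemma matching_insert:
  "matching E M \<Longrightarrow> e \<in> E \<Longrightarrow> e \<inter> \<Union>M = {} \<Longrightarrow> matching E (insert e M)"
  unfolding matching_def pairwise_insert disjnt_def by blast

lemma matching_Diff: "matching E M \<Longrightarrow> matching E (M - A)"
  unfolding matching_def pairwise_def by blast

lemma matching_Diff_Union:
  assumes "matching E M" "e \<in> M"
  shows "\<Union>(M - {e}) = \<Union>M - e"
proof -
  have "e' \<inter> e = {}" if "e' \<in> M - {e}" for e'
    using assms that by (auto simp: matching_def pairwise_def disjnt_def)
  then show ?thesis by blast
qed

lemma matching_Un:
  assumes "matching E M" "matching E N" "\<Union>M \<inter> \<Union>N = {}"
  shows "matching E (M \<union> N)"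
proof -
  have "disjnt e f" "disjnt f e" if "e \<in> M" "f \<in> N" for e f
    using assms(3) that unfolding disjnt_def by blast+
  then show ?thesis
    using assms(1,2) unfolding matching_def pairwise_def by (auto simp: Ball_def)
qed

lemma three_graph_finite: "three_graph V E \<Longrightarrow> finite V \<and> finite E"
  unfolding three_graph_def by (auto intro: finite_subset[of E "Pow V"])

lemma three_graph_edge:
  assumes "three_graph V E" "{x, y, z} \<in> E"
  shows "x \<in> V" "y \<in> V" "z \<in> V" "x \<noteq> y" "x \<noteq> z" "y \<noteq> z"
proof -
  have *: "{x, y, z} \<subseteq> V" "card {x, y, z} = 3"
    using assms unfolding three_graph_def by auto
  then show "x \<in> V" "y \<in> V" "z \<in> V" by auto
  show "x \<noteq> y" "x \<noteq> z" "y \<noteq> z"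
    using *(2) by (auto simp: card_insert_if split: if_splits)
qed

lemma card_Union_matching:
  assumes "three_graph V E" "matching E M"
  shows "card (\<Union>M) = 3 * card M"
proof -
  have e: "finite A" "card A = 3" if "A \<in> M" for A
    using assms that unfolding three_graph_def matching_def
    by (meson finite_subset subsetD)+
  have "card (\<Union>M) = sum card M"
    using assms e by (intro card_Union_disjoint) (auto simp: matching_def)
  also have "\<dots> = 3 * card M" using e by simp
  finally show ?thesis .
qed

lemma matching_Union_subset:
  "three_graph V E \<Longrightarrow> matching E M \<Longrightarrow> \<Union>M \<subseteq> V"
  unfolding three_graph_def matching_def by blast

section \<open>Maximum matchings under codegree at least one third\<close>

text \<open>If two of the sets are non-empty, the coincidence conditions force all three into one
  common singleton; otherwise only one set contributes, and it lies in \<open>e\<close>. Here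
  \<open>e\<close> will be a matching edge, and the sets the parts of it seen by three disjoint
  uncovered pairs.\<close>

lemma card_sum_three_le:
  assumes e: "finite e" "card e = 3" and sub: "A \<subseteq> e" "B \<subseteq> e" "C \<subseteq> e"
    and AB: "\<And>a b. a \<in> A \<Longrightarrow> b \<in> B \<Longrightarrow> a = b"
    and AC: "\<And>a b. a \<in> A \<Longrightarrow> b \<in> C \<Longrightarrow> a = b"
    and BC: "\<And>a b. a \<in> B \<Longrightarrow> b \<in> C \<Longrightarrow> a = b"
  shows "card A + card B + card C \<le> 3"
proof -
  have 3: "card A \<le> 3" "card B \<le> 3" "card C \<le> 3"
    using e sub by (metis card_mono)+
  have 1: "card A \<le> 1 \<and> card B \<le> 1 \<and> card C \<le> 1" if "\<exists>v. A \<subseteq> {v} \<and> B \<subseteq> {v} \<and> C \<subseteq> {v}"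
    using that by (metis card.empty card_1_singleton_iff le_numeral_extra(4) subset_singletonD zero_le One_nat_def)
  consider "A = {}" "B = {}" | "A = {}" "C = {}" | "B = {}" "C = {}"
    | "\<exists>v. A \<subseteq> {v} \<and> B \<subseteq> {v} \<and> C \<subseteq> {v}"
    using AB AC BC by blast
  then show ?thesis
    using 3 1 by cases auto
qed

text \<open>With six vertices outside a maximum matching \<open>M\<close>, three disjoint uncovered
  pairs would have total degree at least \<open>card V\<close>. All their neighbours are covered,
  and each edge of \<open>M\<close> holds at most three of them counted with multiplicity, so the
  total is at most \<open>3 * card M\<close>, which is less than \<open>card V\<close>.\<close>

lemma near_perfect_matching:
  fixes V :: "'a set"
  assumes g: "three_graph V E" and dvd: "3 dvd card V"
    and deg: "\<And>x y. x \<in> V \<Longrightarrow> y \<in> V \<Longrightarrow> x \<noteq> y \<Longrightarrow> card V \<le> 3 * pair_degree V E x y"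
  obtains M where "matching E M" "card (V - \<Union>M) = 0 \<or> card (V - \<Union>M) = 3"
proof -
  have fin: "finite V" "finite E" using three_graph_finite[OF g] by auto
  have "\<exists>M. matching E M \<and> (\<forall>M'. matching E M' \<longrightarrow> card M' \<le> card M)"
  proof -
    have fin_all: "finite (Collect (matching E))"
      by (rule finite_subset[of _ "Pow E"]) (auto simp: matching_def fin)
    then obtain M where "matching E M" "card M = Max (card ` Collect (matching E))"
      using Max_in[of "card ` Collect (matching E)"] matching_empty[of E] by fastforce
    with fin_all show ?thesis by (intro exI[of _ M]) auto
  qed
  then obtain M where M: "matching E M" and max: "\<And>M'. matching E M' \<Longrightarrow> card M' \<le> card M"
    by blast
  have finM: "finite M" using M fin by (auto simp: matching_def intro: finite_subset)
  define U where "U = V - \<Union>M"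
  have MV: "\<Union>M \<subseteq> V" using matching_Union_subset[OF g M] .
  have cU: "card U = card V - 3 * card M"
    unfolding U_def using card_Union_matching[OF g M] MV fin
    by (metis card_Diff_subset finite_subset)
  have cle: "3 * card M \<le> card V"
    using card_Union_matching[OF g M] MV fin by (metis card_mono)
  have "card U < 6"
  proof (rule ccontr)
    assume "\<not> card U < 6"
    then obtain S where S: "S \<subseteq> U" "card S = 6" "finite S"
      by (metis not_less obtain_subset_with_card_n)
    obtain us where us: "distinct us" "set us = S" "length us = 6"
      using S by (metis distinct_card finite_distinct_list)
    then obtain x1 y1 x2 y2 x3 y3 where us': "us = [x1,y1,x2,y2,x3,y3]"
      by (auto simp: length_Suc_conv eval_nat_numeral)
    define N where "N x y = {z \<in> V. {x, y, z} \<in> E}" for x y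
    \<comment> \<open>An uncovered neighbour would give an edge disjoint from \<open>M\<close>,
      against maximality.\<close>
    have in_M: "N x y \<subseteq> \<Union>M" if "x \<in> U" "y \<in> U" for x y
    proof
      fix z assume z: "z \<in> N x y"
      show "z \<in> \<Union>M"
      proof (rule ccontr)
        assume "z \<notin> \<Union>M"
        then have "matching E (insert {x,y,z} M)"
          using M z that by (intro matching_insert) (auto simp: N_def U_def)
        moreover have "{x,y,z} \<notin> M" using that by (auto simp: U_def)
        ultimately show False using max finM by fastforce
      qed
    qed
    \<comment> \<open>If \<open>a\<close> and \<open>b\<close> differed, replacing \<open>e\<close>
      by \<open>{x, y, a}\<close> and \<open>{x', y', b}\<close> would enlarge the matching by
      one.\<close>
    have swap: "a = b"
      if d: "distinct [x,y,x',y']" "{x,y,x',y'} \<subseteq> U" and e: "e \<in> M"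
        and a: "a \<in> N x y \<inter> e" and b: "b \<in> N x' y' \<inter> e" for x y x' y' e a b
    proof (rule ccontr)
      assume "a \<noteq> b"
      let ?M = "M - {e}"
      have U: "\<Union>?M = \<Union>M - e" by (rule matching_Diff_Union[OF M e])
      have eM: "e \<subseteq> \<Union>M" using e by auto
      have out: "x \<notin> \<Union>M" "y \<notin> \<Union>M" "x' \<notin> \<Union>M" "y' \<notin> \<Union>M" and ab: "a \<in> \<Union>M" "b \<in> \<Union>M" "a \<in> e" "b \<in> e"
        using d(2) a b eM by (auto simp: U_def)
      then have ne: "b \<noteq> x" "b \<noteq> y" "x' \<noteq> a" "y' \<noteq> a" by metis+
      have 1: "matching E (insert {x,y,a} ?M)"
        using a out ab by (intro matching_insert matching_Diff M) (simp_all add: U N_def del: Union_iff)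
      have "{x',y',b} \<inter> \<Union>(insert {x,y,a} ?M) = {}"
        unfolding Union_insert U using out ab ne d(1) \<open>a \<noteq> b\<close> by (simp add: eq_commute del: Union_iff)
      then have 2: "matching E (insert {x',y',b} (insert {x,y,a} ?M))"
        using b by (intro matching_insert 1) (simp add: N_def)
      have "x' \<notin> {x,y,a}" using d(1) ne by auto
      then have "{x,y,a} \<notin> M" "{x',y',b} \<notin> M" "{x',y',b} \<noteq> {x,y,a}"
        using out by blast+
      then have "card (insert {x',y',b} (insert {x,y,a} ?M)) = card M + 1"
        using finM e by (simp add: card_Diff_singleton card_gt_0_iff)
          (metis Suc_pred card_gt_0_iff empty_iff)
      with max[OF 2] show False by simp
    qed
    have fe: "finite e" "card e = 3" if "e \<in> M" for e
      using that M g fin unfolding matching_def three_graph_def by (meson finite_subset subsetD)+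
    have cN: "card (N x y) = (\<Sum>e\<in>M. card (N x y \<inter> e))" if "x \<in> U" "y \<in> U" for x y
    proof -
      have "N x y = (\<Union>e\<in>M. N x y \<inter> e)" using in_M[OF that] by blast
      then have "card (N x y) = card (\<Union>e\<in>M. N x y \<inter> e)" by simp
      also have "\<dots> = (\<Sum>e\<in>M. card (N x y \<inter> e))"
      proof (rule card_UN_disjoint)
        show "\<forall>e\<in>M. finite (N x y \<inter> e)" using fe by simp
        show "\<forall>e\<in>M. \<forall>e'\<in>M. e \<noteq> e' \<longrightarrow> (N x y \<inter> e) \<inter> (N x y \<inter> e') = {}"
          using M unfolding matching_def pairwise_def disjnt_def by blast
      qed (rule finM)
      finally show ?thesis .
    qed
    have u: "distinct [x1,y1,x2,y2,x3,y3]" "{x1,y1,x2,y2,x3,y3} \<subseteq> U"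
      using us us' S by auto
    have "card (N x1 y1) + card (N x2 y2) + card (N x3 y3)
        = (\<Sum>e\<in>M. card (N x1 y1 \<inter> e) + card (N x2 y2 \<inter> e) + card (N x3 y3 \<inter> e))"
      using u by (simp add: cN sum.distrib)
    also have "\<dots> \<le> (\<Sum>e\<in>M. 3)"
    proof (rule sum_mono)
      fix e assume e: "e \<in> M"
      show "card (N x1 y1 \<inter> e) + card (N x2 y2 \<inter> e) + card (N x3 y3 \<inter> e) \<le> 3"
      proof (rule card_sum_three_le[OF fe[OF e]])
        show "a = b" if "a \<in> N x1 y1 \<inter> e" "b \<in> N x2 y2 \<inter> e" for a b
          using u by (intro swap[OF _ _ e that]) auto
        show "a = b" if "a \<in> N x1 y1 \<inter> e" "b \<in> N x3 y3 \<inter> e" for a b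
          using u by (intro swap[OF _ _ e that]) auto
        show "a = b" if "a \<in> N x2 y2 \<inter> e" "b \<in> N x3 y3 \<inter> e" for a b
          using u by (intro swap[OF _ _ e that]) auto
      qed auto
    qed
    also have "\<dots> = 3 * card M" by simp
    finally have le: "card (N x1 y1) + card (N x2 y2) + card (N x3 y3) \<le> 3 * card M" .
    have "card V \<le> 3 * card (N x y)" if "x \<in> U" "y \<in> U" "x \<noteq> y" for x y
      using deg[of x y] that by (auto simp: U_def N_def pair_degree_def)
    then have "card V \<le> 3 * card (N x1 y1)" "card V \<le> 3 * card (N x2 y2)" "card V \<le> 3 * card (N x3 y3)"
      using u by auto
    with le cU \<open>\<not> card U < 6\<close> show False by linarith
  qed
  \<comment> \<open>Fewer than six uncovered vertices, in a number divisible by 3, leaves only 0 and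
    3.\<close>
  moreover have "3 dvd card U" using cU dvd by (simp add: cle)
  ultimately have "card U = 0 \<or> card U = 3" by presburger
  then show thesis using that M unfolding U_def by blast
qed

section \<open>Extending an edge to a complete K4\<close>

text \<open>A vertex \<open>w\<close> in two of the three pair neighbourhoods of the edge makes
  \<open>{x, y, z, w}\<close> span at least three edges, hence all four. So every pairwise
  intersection equals the triple one, and the three degrees, at least \<open>3 * d\<close> in total,
  count the union once and the triple intersection twice more.\<close>

lemma card_K4_extensions:
  assumes g: "three_graph V E" and free: "induced_K4_minus_free V E"
    and deg: "\<And>x y. x \<in> V \<Longrightarrow> y \<in> V \<Longrightarrow> x \<noteq> y \<Longrightarrow> d \<le> real (pair_degree V E x y)"
    and e: "{x, y, z} \<in> E"
  shows "(3 * d - real (card V)) / 2 \<le> real (card {w \<in> V. {x, y, w} \<in> E \<and> {x, z, w} \<in> E \<and> {y, z, w} \<in> E})"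
proof -
  define A B C where "A = {w \<in> V. {x, y, w} \<in> E}" and "B = {w \<in> V. {x, z, w} \<in> E}"
    and "C = {w \<in> V. {y, z, w} \<in> E}"
  have fin: "finite V" "finite A" "finite B" "finite C"
    using three_graph_finite[OF g] by (auto simp: A_def B_def C_def)
  note xyz = three_graph_edge[OF g e]
  have "{x,y,w} \<in> E \<and> {x,z,w} \<in> E \<and> {y,z,w} \<in> E"
    if w: "w \<in> V" and two: "({x,y,w} \<in> E \<and> {x,z,w} \<in> E) \<or> ({x,y,w} \<in> E \<and> {y,z,w} \<in> E) \<or> ({x,z,w} \<in> E \<and> {y,z,w} \<in> E)"
    for w
  proof (rule ccontr)
    assume not3: "\<not> ?thesis"
    have ne: "w \<noteq> x" "w \<noteq> y" "w \<noteq> z"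
      using two three_graph_edge[OF g] by blast+
    let ?W = "{x,y,z,w}"
    \<comment> \<open>A 3-subset of the 4-set omits exactly one point, so there are only these four
      candidates.\<close>
    have sub: "s \<in> {{x,y,z},{x,y,w},{x,z,w},{y,z,w}}" if "s \<subseteq> ?W" "card s = 3" for s
    proof -
      have "card (?W - s) = 1"
        using that ne xyz by (subst card_Diff_subset) (auto intro: finite_subset)
      then obtain v where v: "?W - s = {v}" by (auto simp: card_Suc_eq)
      then have "s = ?W - {v}" "v \<in> ?W" using that by blast+
      then show ?thesis using ne xyz by auto
    qed
    have d: "{x,y,z} \<noteq> {x,y,w}" "{x,y,z} \<noteq> {x,z,w}" "{x,y,z} \<noteq> {y,z,w}"
        "{x,y,w} \<noteq> {x,z,w}" "{x,y,w} \<noteq> {y,z,w}" "{x,z,w} \<noteq> {y,z,w}"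
      using ne xyz by auto
    have c3: "card s = 3" if "s \<in> {{x,y,z},{x,y,w},{x,z,w},{y,z,w}}" for s
      using that ne xyz by auto
    have "{s \<in> E. s \<subseteq> ?W \<and> card s = 3} = {s \<in> {{x,y,z},{x,y,w},{x,z,w},{y,z,w}}. s \<in> E}"
      using sub c3 by blast
    moreover have "card {s \<in> {{x,y,z},{x,y,w},{x,z,w},{y,z,w}}. s \<in> E} = 3"
    proof -
      consider "{x,y,w} \<notin> E" "{x,z,w} \<in> E" "{y,z,w} \<in> E"
        | "{x,y,w} \<in> E" "{x,z,w} \<notin> E" "{y,z,w} \<in> E"
        | "{x,y,w} \<in> E" "{x,z,w} \<in> E" "{y,z,w} \<notin> E"
        using two not3 by blast
      then show ?thesis
      proof cases
        case 1
        then have "{s \<in> {{x,y,z},{x,y,w},{x,z,w},{y,z,w}}. s \<in> E} = {{x,y,z},{x,z,w},{y,z,w}}"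
          using e by blast
        then show ?thesis using d by simp
      next
        case 2
        then have "{s \<in> {{x,y,z},{x,y,w},{x,z,w},{y,z,w}}. s \<in> E} = {{x,y,z},{x,y,w},{y,z,w}}"
          using e by blast
        then show ?thesis using d by simp
      next
        case 3
        then have "{s \<in> {{x,y,z},{x,y,w},{x,z,w},{y,z,w}}. s \<in> E} = {{x,y,z},{x,y,w},{x,z,w}}"
          using e by blast
        then show ?thesis using d by simp
      qed
    qed
    moreover have "?W \<subseteq> V" "card ?W = 4" using w xyz ne by auto
    ultimately show False using free unfolding induced_K4_minus_free_def by metis
  qed
  then have T: "A \<inter> B = A \<inter> B \<inter> C" "(A \<union> B) \<inter> C = A \<inter> B \<inter> C"
    unfolding A_def B_def C_def by blast+
  \<comment> \<open>Inclusion-exclusion, first for \<open>A\<close> and \<open>B\<close>, then for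
    their union and \<open>C\<close>; by \<open>T\<close> both overlaps are the triple
    intersection.\<close>
  have "card A + card B + card C = card (A \<union> B \<union> C) + 2 * card (A \<inter> B \<inter> C)"
    using card_Un_Int[of A B] card_Un_Int[of "A \<union> B" C] fin T by simp
  moreover have "card (A \<union> B \<union> C) \<le> card V"
    using fin by (intro card_mono) (auto simp: A_def B_def C_def)
  moreover have "d \<le> card A" "d \<le> card B" "d \<le> card C"
    using deg[of x y] deg[of x z] deg[of y z] xyz
    by (auto simp: A_def B_def C_def pair_degree_def)
  moreover have "{w \<in> V. {x, y, w} \<in> E \<and> {x, z, w} \<in> E \<and> {y, z, w} \<in> E} = A \<inter> B \<inter> C"
    by (auto simp: A_def B_def C_def)
  ultimately show ?thesis by simp
qed

section \<open>Counting absorbers of a non-edge\<close>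

text \<open>Trading \<open>{a, b, c}\<close> for \<open>{x, y, a}\<close> and
  \<open>{z, b, c}\<close> covers \<open>x\<close>, \<open>y\<close>, \<open>z\<close> as well.
  Ordered triples record which vertex plays which role and allow counting in a Cartesian product.
  Disjointness of the two triples is supplied where the trade is made.\<close>

definition absorbs :: "'a set set \<Rightarrow> 'a \<times> 'a \<times> 'a \<Rightarrow> 'a \<times> 'a \<times> 'a \<Rightarrow> bool" where
  "absorbs E = (\<lambda>(a, b, c) (x, y, z). {a, b, c} \<in> E \<and> {x, y, a} \<in> E \<and> {z, b, c} \<in> E)"

lemma real_card_Sigma_ge:
  assumes "finite A" "\<And>a. a \<in> A \<Longrightarrow> finite (B a)" "\<And>a. a \<in> A \<Longrightarrow> k \<le> real (card (B a))"
  shows "real (card A) * k \<le> real (card (Sigma A B))"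
proof -
  have "real (card A) * k = (\<Sum>a\<in>A. k)" by simp
  also have "\<dots> \<le> (\<Sum>a\<in>A. real (card (B a)))" by (intro sum_mono assms)
  also have "\<dots> = real (card (Sigma A B))" using assms by simp
  finally show ?thesis .
qed

text \<open>Choose \<open>a\<close> among the neighbours of the pair \<open>x\<close>,
  \<open>y\<close>, then \<open>b\<close> among those of \<open>a\<close>, \<open>z\<close>, then
  \<open>c\<close> completing the edge \<open>{a, z, b}\<close> to a K4. The first two choices have
  at least \<open>d\<close> options each, the last at least
  \<open>(3 * d - card V) / 2\<close>.\<close>

lemma card_absorbers:
  fixes d :: real
  assumes g: "three_graph V E" and free: "induced_K4_minus_free V E"
    and deg: "\<And>x y. x \<in> V \<Longrightarrow> y \<in> V \<Longrightarrow> x \<noteq> y \<Longrightarrow> d \<le> real (pair_degree V E x y)"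
    and d: "card V \<le> 3 * d"
    and xyz: "x \<in> V" "y \<in> V" "z \<in> V" "x \<noteq> y" "{x, y, z} \<notin> E"
  shows "d * d * ((3 * d - card V) / 2) \<le> card {s \<in> V \<times> V \<times> V. absorbs E s (x, y, z)}"
proof -
  define k where "k = (3 * d - card V) / 2"
  have k0: "0 \<le> k" "0 \<le> d" using d by (auto simp: k_def)
  have fin: "finite V" using three_graph_finite[OF g] by auto
  define N where "N u v = {w \<in> V. {u, v, w} \<in> E}" for u v
  define K where "K u v w = {t \<in> V. {u,v,t} \<in> E \<and> {u,w,t} \<in> E \<and> {v,w,t} \<in> E}" for u v w
  have finN: "finite (N u v)" "finite (K u v w)" for u v w using fin by (auto simp: N_def K_def)
  have N: "d \<le> card (N u v)" if "u \<in> V" "v \<in> V" "u \<noteq> v" for u v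
    using deg[OF that] by (simp add: N_def pair_degree_def)
  have K: "k \<le> card (K u v w)" if "{u,v,w} \<in> E" for u v w
    unfolding k_def K_def by (rule card_K4_extensions[OF g free deg that])
  have inner: "d * k \<le> card (Sigma (N a z) (\<lambda>b. K a z b))" if a: "a \<in> N x y" for a
  proof -
    \<comment> \<open>Here the non-edge condition enters: \<open>a = z\<close> would make
      \<open>{x, y, z}\<close> an edge.\<close>
    have "a \<in> V" "a \<noteq> z" using a xyz by (auto simp: N_def)
    then have "d * k \<le> card (N a z) * k"
      using N[of a z] xyz k0 by (intro mult_right_mono) auto
    also have "\<dots> \<le> card (Sigma (N a z) (\<lambda>b. K a z b))"
      by (intro real_card_Sigma_ge finN K) (auto simp: N_def)
    finally show ?thesis .
  qed
  have "d * (d * k) \<le> card (N x y) * (d * k)"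
    using N[of x y] xyz k0 by (intro mult_right_mono) auto
  also have "\<dots> \<le> card (Sigma (N x y) (\<lambda>a. Sigma (N a z) (\<lambda>b. K a z b)))"
    by (intro real_card_Sigma_ge finN inner finite_SigmaI)
  \<comment> \<open>Of the three edges that the K4 gives at \<open>c\<close>, \<open>absorbs\<close>
    uses \<open>{a, b, c}\<close> and \<open>{z, b, c}\<close>.\<close>
  also have "\<dots> \<le> card {s \<in> V \<times> V \<times> V. absorbs E s (x, y, z)}"
    using fin by (intro of_nat_mono card_mono) (auto simp: N_def K_def absorbs_def insert_commute)
  finally show ?thesis by (simp add: k_def mult.assoc)
qed

section \<open>Greedy choice of an absorbing matching\<close>

text \<open>Double counting of related pairs: some \<open>y\<close> does at least as well as the
  average. The factor \<open>card Y\<close> stays on the right to avoid a division.\<close>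

lemma ex_popular:
  assumes "finite X" "finite Y" "Y \<noteq> {}"
    and "\<And>x. x \<in> X \<Longrightarrow> k \<le> real (card {y \<in> Y. R x y})"
  shows "\<exists>y\<in>Y. real (card X) * k \<le> real (card Y) * real (card {x \<in> X. R x y})"
proof (rule ccontr)
  assume "\<not> ?thesis"
  then have less: "real (card Y) * real (card {x \<in> X. R x y}) < real (card X) * k" if "y \<in> Y" for y
    using that by (auto simp: not_le)
  have ind: "real (card {y \<in> A. P y}) = (\<Sum>y\<in>A. if P y then 1 else 0)" if "finite A" for A :: "'c set" and P
    using that by (simp add: sum.If_cases Int_def)
  have "real (card X) * k = (\<Sum>x\<in>X. k)" by simp
  also have "\<dots> \<le> (\<Sum>x\<in>X. real (card {y \<in> Y. R x y}))" by (intro sum_mono assms)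
  also have "\<dots> = (\<Sum>y\<in>Y. real (card {x \<in> X. R x y}))"
    using assms sum.swap[of "\<lambda>x y. if R x y then 1 else 0 :: real" Y X]
    by (simp add: sum.If_cases Int_def)
  finally have "card Y * (real (card X) * k) \<le> (\<Sum>y\<in>Y. card Y * real (card {x \<in> X. R x y}))"
    by (simp add: sum_distrib_left[symmetric] mult_left_mono)
  also have "\<dots> < (\<Sum>y\<in>Y. real (card X) * k)"
    using assms less by (intro sum_strict_mono) auto
  finally show False by simp
qed

text \<open>Each round adds the most popular absorber disjoint from the earlier ones, which handles
  at least a fraction \<open>\<gamma> / 12\<close> of the triples still unabsorbed. The bound on
  \<open>m\<close> keeps the used vertices so few that at least half of the guaranteed number of
  absorbers of each triple stay available.\<close>

lemma absorbing_matching: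
  fixes V :: "'a set" and \<gamma> :: real
  assumes g: "three_graph V E" and free: "induced_K4_minus_free V E"
    and \<gamma>: "0 < \<gamma>" "\<gamma> \<le> 1" and V: "V \<noteq> {}"
    and deg: "\<And>x y. x \<in> V \<Longrightarrow> y \<in> V \<Longrightarrow> x \<noteq> y \<Longrightarrow> (1 / 3 + \<gamma>) * card V \<le> real (pair_degree V E x y)"
    and m: "real m \<le> \<gamma> * card V / 108"
  shows "\<exists>F. matching E F \<and> card F \<le> m \<and>
    card {t \<in> V \<times> V \<times> V. (case t of (x, y, z) \<Rightarrow> x \<noteq> y \<and> {x, y, z} \<notin> E) \<and>
      \<not> (\<exists>a b c. {a, b, c} \<in> F \<and> absorbs E (a, b, c) t)} \<le> real (card V) ^ 3 * (1 - \<gamma> / 12) ^ m"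
  using m
proof (induction m)
  case 0
  have "finite V" using three_graph_finite[OF g] by auto
  then have "card {t \<in> V \<times> V \<times> V. P t} \<le> card V ^ 3" for P
    using card_mono[of "V \<times> V \<times> V" "{t \<in> V \<times> V \<times> V. P t}"]
    by (simp add: card_cartesian_product power3_eq_cube mult.assoc)
  then show ?case by (intro exI[of _ "{}"]) (simp flip: of_nat_power)
next
  case (Suc m)
  define n where "n = real (card V)"
  have fin: "finite V" "finite E" using three_graph_finite[OF g] by auto
  have n0: "0 < n" using fin V by (simp add: n_def card_gt_0_iff)
  define X where "X F = {t \<in> V \<times> V \<times> V. (case t of (x, y, z) \<Rightarrow> x \<noteq> y \<and> {x, y, z} \<notin> E) \<and>
      \<not> (\<exists>a b c. {a, b, c} \<in> F \<and> absorbs E (a, b, c) t)}" for F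
  obtain F where F: "matching E F" "card F \<le> m" and XF: "card (X F) \<le> n ^ 3 * (1 - \<gamma> / 12) ^ m"
    using Suc unfolding X_def n_def by auto
  have finF: "finite F" using F fin by (auto simp: matching_def intro: finite_subset)
  have finX: "finite (X G)" for G
    unfolding X_def by (rule finite_subset[of _ "V \<times> V \<times> V"]) (use fin in auto)
  define W where "W = \<Union>F"
  have WV: "W \<subseteq> V" unfolding W_def by (rule matching_Union_subset[OF g F(1)])
  then have finW: "finite W" using fin(1) by (rule finite_subset)
  \<comment> \<open>Three vertices per edge turn the 108 in the bound on \<open>m\<close> into
    36.\<close>
  have cW: "card W \<le> \<gamma> * n / 36"
    unfolding W_def card_Union_matching[OF g F(1)] using F(2) Suc.prems by (simp add: n_def)
  define R where "R s t \<longleftrightarrow> absorbs E s t \<and> (case s of (a, b, c) \<Rightarrow> {a, b, c} \<inter> W = {})" for s t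
  have many: "\<gamma> / 12 * n ^ 3 \<le> card {s \<in> V \<times> V \<times> V. R s t}" if t: "t \<in> X F" for t
  proof -
    let ?S = "{s \<in> V \<times> V \<times> V. R s t}"
    obtain x y z where t': "t = (x, y, z)" by (cases t)
    let ?A = "{s \<in> V \<times> V \<times> V. absorbs E s t}"
    \<comment> \<open>\<open>?B\<close> holds the triples spoiled by meeting \<open>W\<close>: at
      most \<open>\<gamma> * n ^ 3 / 12\<close>, against at least
      \<open>\<gamma> * n ^ 3 / 6\<close> absorbers.\<close>
    let ?B = "W \<times> V \<times> V \<union> V \<times> W \<times> V \<union> V \<times> V \<times> W"
    have d: "real (card V) \<le> 3 * ((1 / 3 + \<gamma>) * card V)" using \<gamma> by (simp add: algebra_simps)
    have "(n / 3) * (n / 3) * (3 * \<gamma> * n / 2)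
        \<le> (1 / 3 + \<gamma>) * n * ((1 / 3 + \<gamma>) * n) * ((3 * ((1 / 3 + \<gamma>) * n) - n) / 2)"
      using \<gamma> n0 by (intro mult_mono) (auto simp: field_simps)
    also have "\<dots> \<le> card ?A"
      using t t' card_absorbers[OF g free deg d, of x y z] by (auto simp: n_def X_def)
    finally have 1: "\<gamma> * n ^ 3 / 6 \<le> card ?A" by (simp add: power3_eq_cube)
    have "card ?B \<le> card (W \<times> V \<times> V) + card (V \<times> W \<times> V) + card (V \<times> V \<times> W)"
      by (meson add_le_mono card_Un_le le_refl le_trans)
    then have "card ?B \<le> 3 * (card W * (card V * card V))"
      by (simp add: card_cartesian_product algebra_simps)
    then have "real (card ?B) \<le> 3 * (real (card W) * (n * n))"
      unfolding n_def by (metis (no_types, lifting) of_nat_le_iff of_nat_mult of_nat_numeral)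
    also have "\<dots> \<le> 3 * (\<gamma> * n / 36 * (n * n))"
      using cW by (intro mult_left_mono mult_right_mono) auto
    finally have 2: "card ?B \<le> \<gamma> * n ^ 3 / 12" by (simp add: power3_eq_cube)
    have "?A \<subseteq> ?S \<union> ?B" by (auto simp: R_def)
    then have "card ?A \<le> card (?S \<union> ?B)"
      using fin finW by (intro card_mono) auto
    also have "\<dots> \<le> card ?S + card ?B" by (rule card_Un_le)
    finally have "real (card ?A) \<le> card ?S + card ?B" by linarith
    with 1 2 show ?thesis by simp
  qed
  define Y where "Y = V \<times> V \<times> V"
  have Y: "finite Y" "Y \<noteq> {}" "card Y = n ^ 3"
    using fin V by (auto simp: Y_def n_def card_cartesian_product power3_eq_cube)
  obtain s where "s \<in> Y"
    and s: "card (X F) * (\<gamma> / 12 * n ^ 3) \<le> card Y * real (card {t \<in> X F. R s t})"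
    using ex_popular[OF finX[of F] Y(1,2), of "\<gamma> / 12 * n ^ 3" "\<lambda>t s. R s t"] many
    unfolding Y_def by blast
  let ?P = "{t \<in> X F. R s t}"
  have "n ^ 3 * (card (X F) * (\<gamma> / 12)) \<le> n ^ 3 * card ?P"
    using s by (simp add: Y(3) mult_ac)
  then have pop: "card (X F) * (\<gamma> / 12) \<le> card ?P"
    using n0 by (subst (asm) mult_le_cancel_left_pos) auto
  obtain a b c where abc: "s = (a, b, c)" by (cases s)
  show ?case
  \<comment> \<open>If \<open>?P\<close> is empty, \<open>pop\<close> shows that nothing is left to
    absorb and \<open>F\<close> is kept. Otherwise any member of \<open>?P\<close> certifies that
    \<open>{a, b, c}\<close> is an edge avoiding \<open>W\<close>.\<close>
  proof (cases "?P = {}")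
    case True
    have "card (X F) * (\<gamma> / 12) \<le> 0" using pop unfolding True by simp
    then have "card (X F) = 0" using \<gamma> by (simp add: mult_le_0_iff)
    then have "card (X F) \<le> n ^ 3 * (1 - \<gamma> / 12) ^ Suc m" using \<gamma> n0 by simp
    then show ?thesis using F unfolding X_def n_def by (intro exI[of _ F]) simp
  next
    case False
    then have e: "{a, b, c} \<in> E" "{a, b, c} \<inter> W = {}" by (auto simp: abc R_def absorbs_def)
    define G where "G = insert {a, b, c} F"
    have "matching E G" unfolding G_def using F e by (intro matching_insert) (auto simp: W_def)
    moreover have "card G \<le> Suc m"
      unfolding G_def using finF F(2) by (simp add: card_insert_if)
    moreover have "card (X G) \<le> n ^ 3 * (1 - \<gamma> / 12) ^ Suc m"
    proof -
      have "X G \<subseteq> X F - ?P" by (auto simp: X_def G_def abc R_def)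
      then have "card (X G) \<le> card (X F - ?P)" using finX by (intro card_mono) auto
      also have "\<dots> = card (X F) - card ?P" using finX by (intro card_Diff_subset) auto
      finally have "real (card (X G)) \<le> card (X F) - real (card ?P)"
        using card_mono[OF finX[of F], of ?P] by auto
      also have "\<dots> \<le> card (X F) * (1 - \<gamma> / 12)" using pop by (simp add: algebra_simps)
      also have "\<dots> \<le> n ^ 3 * (1 - \<gamma> / 12) ^ m * (1 - \<gamma> / 12)"
        using XF \<gamma> by (intro mult_right_mono) auto
      finally show ?thesis by (simp add: mult_ac)
    qed
    ultimately show ?thesis unfolding X_def n_def by blast
  qed
qed

section \<open>Completing the absorbing matching to a perfect one\<close>

text \<open>Set \<open>F\<close> aside, match the rest up to at most three vertices, and let
  \<open>F\<close> absorb those if they do not form an edge. Deleting the \<open>3 * card F\<close>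
  vertices of \<open>F\<close> costs each pair at most that much degree, whence the slack
  \<open>9 * card F\<close>.\<close>

lemma perfect_matching_of_absorbing:
  fixes V :: "'a set" and \<gamma> :: real
  assumes g: "three_graph V E" and dvd: "3 dvd card V"
    and deg: "\<And>x y. x \<in> V \<Longrightarrow> y \<in> V \<Longrightarrow> x \<noteq> y \<Longrightarrow> card V + 9 * card F \<le> 3 * pair_degree V E x y"
    and F: "matching E F"
    and abs: "\<And>x y z. x \<in> V \<Longrightarrow> y \<in> V \<Longrightarrow> z \<in> V \<Longrightarrow> x \<noteq> y \<Longrightarrow> {x, y, z} \<notin> E \<Longrightarrow>
      \<exists>a b c. {a, b, c} \<in> F \<and> absorbs E (a, b, c) (x, y, z)"
  shows "\<exists>M. perfect_matching V E M"
proof -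
  have fin: "finite V" using three_graph_finite[OF g] by auto
  define W where "W = \<Union>F"
  have WV: "W \<subseteq> V" unfolding W_def by (rule matching_Union_subset[OF g F])
  then have finW: "finite W" using fin by (rule finite_subset)
  have cW: "card W = 3 * card F" unfolding W_def by (rule card_Union_matching[OF g F])
  define V' E' where "V' = V - W" and "E' = {e \<in> E. e \<subseteq> V'}"
  have cV': "card V' = card V - 3 * card F" "3 * card F \<le> card V"
    using card_Diff_subset[OF finW WV] card_mono[OF fin WV] by (auto simp: V'_def cW)
  have g': "three_graph V' E'" using g by (auto simp: three_graph_def E'_def V'_def)
  have deg': "card V' \<le> 3 * pair_degree V' E' x y" if "x \<in> V'" "y \<in> V'" "x \<noteq> y" for x y
  proof -
    have "{z \<in> V. {x, y, z} \<in> E} \<subseteq> {z \<in> V'. {x, y, z} \<in> E'} \<union> W"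
      using that by (auto simp: V'_def E'_def)
    then have "card {z \<in> V. {x, y, z} \<in> E} \<le> card ({z \<in> V'. {x, y, z} \<in> E'} \<union> W)"
      using fin finW by (intro card_mono) (auto simp: V'_def)
    also have "\<dots> \<le> card {z \<in> V'. {x, y, z} \<in> E'} + card W" by (rule card_Un_le)
    finally have "pair_degree V E x y \<le> pair_degree V' E' x y + 3 * card F"
      by (simp add: pair_degree_def cW)
    with deg[of x y] that cV' show ?thesis by (auto simp: V'_def)
  qed
  have "3 dvd card V'" using dvd cV' by simp
  then obtain M where M': "matching E' M" and cM: "card (V' - \<Union>M) = 0 \<or> card (V' - \<Union>M) = 3"
    using near_perfect_matching[OF g' _ deg'] by blast
  have M: "matching E M" using M' by (auto simp: matching_def E'_def)
  have MV: "\<Union>M \<subseteq> V'" by (rule matching_Union_subset[OF g' M'])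
  define T where "T = V' - \<Union>M"
  have MF: "matching E (M \<union> F)"
    using MV by (intro matching_Un M F) (auto simp: V'_def W_def)
  have MFU: "\<Union>(M \<union> F) = V - T"
    using MV WV by (auto simp: T_def V'_def W_def)
  have TV: "T \<subseteq> V" by (auto simp: T_def V'_def)
  show ?thesis
  proof (cases "card T = 0")
    case True
    then have "T = {}" using fin by (auto simp: T_def V'_def)
    then show ?thesis using MF MFU by (auto simp: perfect_matching_iff)
  next
    case False
    then have "card T = 3" using cM by (simp add: T_def)
    then obtain x y z where T: "T = {x, y, z}" and d: "x \<noteq> y" "x \<noteq> z" "y \<noteq> z"
      by (auto simp: card_3_iff)
    show ?thesis
    proof (cases "{x, y, z} \<in> E")
      case True
      then have "matching E (insert T (M \<union> F))"
        using MF MFU T by (intro matching_insert) auto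
      moreover have "\<Union>(insert T (M \<union> F)) = V" using MFU TV by auto
      ultimately show ?thesis by (auto simp: perfect_matching_iff)
    next
      case False
      then obtain a b c where abc: "{a, b, c} \<in> F" and "absorbs E (a, b, c) (x, y, z)"
        using abs[of x y z] T TV d by auto
      then have e: "{x, y, a} \<in> E" "{z, b, c} \<in> E" "{a, b, c} \<in> E" by (auto simp: absorbs_def)
      note ne = three_graph_edge(4-6)[OF g e(3)]
      have aF: "{a, b, c} \<subseteq> W" unfolding W_def using abc by (rule Union_upper)
      have aT: "{a, b, c} \<inter> T = {}" using aF by (auto simp: T_def V'_def)
      \<comment> \<open>The trade: \<open>{a, b, c}\<close> leaves, and \<open>{z, b, c}\<close> and
        \<open>{x, y, a}\<close> enter. They are disjoint because \<open>T\<close> lies outside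
        every edge of \<open>M \<union> F\<close>.\<close>
      let ?M = "M \<union> F - {{a, b, c}}"
      have U: "\<Union>?M = V - T - {a, b, c}"
        using matching_Diff_Union[OF MF, of "{a,b,c}"] abc MFU by auto
      have 1: "matching E (insert {z, b, c} ?M)"
        using U T e by (intro matching_insert matching_Diff MF) auto
      have "{x, y, a} \<inter> \<Union>(insert {z, b, c} ?M) = {}"
        unfolding Union_insert U using aT T d ne by auto
      then have "matching E (insert {x, y, a} (insert {z, b, c} ?M))"
        by (intro matching_insert 1 e)
      moreover have "\<Union>(insert {x, y, a} (insert {z, b, c} ?M)) = V"
        unfolding Union_insert U using aF WV T TV by auto
      ultimately show ?thesis by (auto simp: perfect_matching_iff)
    qed
  qed
qed

section \<open>Choice of parameters for large order\<close>

lemma min_pair_degree_le: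
  assumes "finite V" "x \<in> V" "y \<in> V" "x \<noteq> y"
  shows "min_pair_degree V E \<le> pair_degree V E x y"
proof -
  have "{pair_degree V E x y | x y. x \<in> V \<and> y \<in> V \<and> x \<noteq> y} \<subseteq> (\<lambda>(x, y). pair_degree V E x y) ` (V \<times> V)"
    by auto
  then have "finite {pair_degree V E x y | x y. x \<in> V \<and> y \<in> V \<and> x \<noteq> y}"
    using assms(1) by (meson finite_SigmaI finite_imageI finite_subset)
  then show ?thesis
    unfolding min_pair_degree_def using assms by (intro Min_le) auto
qed

text \<open>Exponential decay beats the cubic factor. This makes the number of unabsorbed triples
  fall below 1 within the permitted number of rounds.\<close>

lemma eventually_cube_times_power_less:
  fixes \<gamma> :: real
  assumes "0 < \<gamma>" "\<gamma> \<le> 1"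
  shows "\<forall>\<^sub>F n in sequentially. real n ^ 3 * (1 - \<gamma> / 12) ^ nat \<lfloor>\<gamma> * real n / 108\<rfloor> < 1"
proof -
  define q where "q = 1 - \<gamma> / 12"
  have q: "0 < q" "q < 1" using assms by (auto simp: q_def)
  define l where "l = - ln q"
  have l: "0 < l" using q by (simp add: l_def)
  \<comment> \<open>The summand \<open>l\<close> in the exponent is the price of the floor, which
    may lower the power of \<open>q\<close> by up to one.\<close>
  have "(\<lambda>n. real n ^ 3 * exp (l - l * \<gamma> / 108 * real n)) \<longlonglongrightarrow> 0"
    using l assms(1) by real_asymp
  also have "(\<lambda>n. real n ^ 3 * exp (l - l * \<gamma> / 108 * real n)) =
      (\<lambda>n. real n ^ 3 * q powr (\<gamma> * real n / 108 - 1))"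
    using q by (simp add: powr_def l_def algebra_simps)
  finally have "(\<lambda>n. real n ^ 3 * q powr (\<gamma> * real n / 108 - 1)) \<longlonglongrightarrow> 0" .
  then have "\<forall>\<^sub>F n in sequentially. real n ^ 3 * q powr (\<gamma> * real n / 108 - 1) < 1"
    by (rule order_tendstoD) simp
  then show ?thesis
  proof eventually_elim
    case (elim n)
    have "q ^ nat \<lfloor>\<gamma> * real n / 108\<rfloor> = q powr real (nat \<lfloor>\<gamma> * real n / 108\<rfloor>)"
      using q by (simp add: powr_realpow)
    also have "\<dots> \<le> q powr (\<gamma> * real n / 108 - 1)"
      using q by (intro powr_mono') linarith+
    finally have "real n ^ 3 * q ^ nat \<lfloor>\<gamma> * real n / 108\<rfloor> \<le> real n ^ 3 * q powr (\<gamma> * real n / 108 - 1)"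
      by (intro mult_left_mono) auto
    with elim show ?case unfolding q_def by linarith
  qed
qed

theorem theorem1p3:
  fixes \<gamma> :: real
  assumes "\<gamma> > 0"
  shows "\<exists>N::nat. \<forall>n\<ge>N. 3 dvd n \<longrightarrow>
    (\<forall>(V :: 'a set) E.
       three_graph V E \<and> card V = n \<and> induced_K4_minus_free V E \<and>
       real (min_pair_degree V E) \<ge> (1 / 3 + \<gamma>) * real n
       \<longrightarrow> (\<exists>M. perfect_matching V E M))"
proof -
  \<comment> \<open>Capping at 1 meets the upper bound required by \<open>absorbing_matching\<close>
    and only weakens the degree condition.\<close>
  define \<beta> where "\<beta> = min \<gamma> 1"
  have \<beta>: "0 < \<beta>" "\<beta> \<le> 1" "\<beta> \<le> \<gamma>" using assms by (auto simp: \<beta>_def)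
  obtain N where N: "real n ^ 3 * (1 - \<beta> / 12) ^ nat \<lfloor>\<beta> * real n / 108\<rfloor> < 1" if "n \<ge> N" for n
    using eventually_cube_times_power_less[OF \<beta>(1,2)] unfolding eventually_sequentially by blast
  show ?thesis
  \<comment> \<open>The 1 ensures that \<open>V\<close> is non-empty.\<close>
  proof (intro exI[of _ "max N 1"] allI impI)
    fix n and V :: "'a set" and E
    assume n: "max N 1 \<le> n" and dvd: "3 dvd n"
      and "three_graph V E \<and> card V = n \<and> induced_K4_minus_free V E \<and>
       real (min_pair_degree V E) \<ge> (1 / 3 + \<gamma>) * real n"
    then have g: "three_graph V E" and cV: "card V = n" and free: "induced_K4_minus_free V E"
      and min: "(1 / 3 + \<gamma>) * real n \<le> real (min_pair_degree V E)"
      by auto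
    have fin: "finite V" using three_graph_finite[OF g] by auto
    have V: "V \<noteq> {}" using cV n by auto
    have deg: "(1 / 3 + \<beta>) * card V \<le> pair_degree V E x y" if "x \<in> V" "y \<in> V" "x \<noteq> y" for x y
    proof -
      have "(1 / 3 + \<beta>) * card V \<le> (1 / 3 + \<gamma>) * n"
        unfolding cV using \<beta> by (intro mult_right_mono) auto
      also note min
      also have "real (min_pair_degree V E) \<le> pair_degree V E x y"
        using min_pair_degree_le[OF fin that] by simp
      finally show ?thesis .
    qed
    let ?m = "nat \<lfloor>\<beta> * real n / 108\<rfloor>"
    have m: "real ?m \<le> \<beta> * card V / 108"
      using \<beta> unfolding cV by (intro of_nat_floor) auto
    let ?X = "\<lambda>F. {t \<in> V \<times> V \<times> V. (case t of (x, y, z) \<Rightarrow> x \<noteq> y \<and> {x, y, z} \<notin> E) \<and>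
      \<not> (\<exists>a b c. {a, b, c} \<in> F \<and> absorbs E (a, b, c) t)}"
    from absorbing_matching[OF g free \<beta>(1,2) V deg m]
    obtain F where F: "matching E F" "card F \<le> ?m"
      and X: "card (?X F) \<le> real (card V) ^ 3 * (1 - \<beta> / 12) ^ ?m"
      by blast
    \<comment> \<open>A cardinality below 1 is 0, so \<open>F\<close> absorbs every
      non-edge.\<close>
    have "real (card (?X F)) < 1" using X N[of n] n by (simp add: cV)
    then have "card (?X F) = 0" by simp
    moreover have "finite (?X F)" by (rule finite_subset[of _ "V \<times> V \<times> V"]) (use fin in auto)
    ultimately have X0: "?X F = {}" by simp
    show "\<exists>M. perfect_matching V E M"
    proof (rule perfect_matching_of_absorbing[OF g _ _ F(1)])
      show "3 dvd card V" using cV dvd by simp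
      show "card V + 9 * card F \<le> 3 * pair_degree V E x y" if "x \<in> V" "y \<in> V" "x \<noteq> y" for x y
      proof -
        \<comment> \<open>So \<open>9 * card F\<close> is at most
          \<open>\<beta> * card V / 12\<close>, well within the surplus
          \<open>3 * \<beta> * card V\<close> of three times the degree.\<close>
        have "real (card F) \<le> \<beta> * card V / 108" using F(2) m by linarith
        moreover have "0 \<le> \<beta> * card V" using \<beta> by simp
        moreover have "card V / 3 + \<beta> * card V \<le> pair_degree V E x y"
          using deg[OF that] by (simp add: algebra_simps)
        ultimately have "real (card V) + 9 * real (card F) \<le> 3 * real (pair_degree V E x y)"
          by linarith
        then show ?thesis by linarith
      qed
      show "\<exists>a b c. {a, b, c} \<in> F \<and> absorbs E (a, b, c) (x, y, z)"
        if "x \<in> V" "y \<in> V" "z \<in> V" "x \<noteq> y" "{x, y, z} \<notin> E" for x y z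
        using X0 that by blast
    qed
  qed
qed

end
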